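(* Let $X$ be a Polish $\mathbb{Z}$-space and let $T:X\to X$ be the homeomorphism given by the action of $1\in\mathbb{Z}$. Suppose that for every nonempty open $V\subseteq X$ there exists $d\ge 1$ such that for every $l\ge 1$ there is a $d$-syndetic set $F\subseteq\mathbb{Z}$ of length at least $l$ with $\bigcap_{n\in F}T^n(V)\neq\emptyset$. Then $X$ does not admit a non-meager Baire measurable weakly wandering subset.
   Context: A Polish $\mathbb{Z}$-space is a Polish space equipped with a continuous action of $\mathbb{Z}$. For $d\ge1$, a finite set $F=\{n_0<n_1<\dots<n_{k-1}\}\subseteq\mathbb{Z}$ is $d$-syndetic if $n_{i+1}-n_i\le d$ for all $i<k-1$; its length is $n_{k-1}-n_0$. A set $A\subseteq X$ is weakly wandering if there is an infinite set $H\subseteq\mathbb{Z}$ such that $T^h(A)\cap T^{h'}(A)=\emptyset$ for all distinct $h,h'\in H$. A set is Baire measurable if it has the Baire property. *)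

theory Defs
  imports "HOL-Analysis.Analysis" "HOL-Algebra.Group_Action" "HOL-Algebra.Elementary_Groups"
begin

definition polish_topology :: "'a topology \<Rightarrow> bool" where
  "polish_topology X \<longleftrightarrow> completely_metrizable_space X \<and> separable_space X"

text \<open>
  The maps \<^term>\<open>\<alpha> n\<close> are elements of \<^term>\<open>BijGroup (topspace X)\<close>, so they are extensional: outside
  of \<^term>\<open>topspace X\<close> they take the value \<^term>\<open>undefined\<close>. The group of integers is discrete.
\<close>
definition polish_Z_space :: "'a topology \<Rightarrow> (int \<Rightarrow> 'a \<Rightarrow> 'a) \<Rightarrow> bool" where
  "polish_Z_space X \<alpha> \<longleftrightarrow>
     polish_topology X \<and>
     group_action integer_group (topspace X) \<alpha> \<and>
     continuous_map (prod_topology (discrete_topology UNIV) X) X (\<lambda>(n, x). \<alpha> n x)"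

definition iter :: "'a topology \<Rightarrow> ('a \<Rightarrow> 'a) \<Rightarrow> int \<Rightarrow> 'a \<Rightarrow> 'a" where
  "iter X T n = T [^]\<^bsub>BijGroup (topspace X)\<^esub> n"

lemma iter_action:
  assumes "polish_Z_space X \<alpha>"
  shows "iter X (\<alpha> 1) n = \<alpha> n"
proof -
  interpret group_hom integer_group "BijGroup (topspace X)" \<alpha>
    using assms by (simp add: polish_Z_space_def group_action_def)
  have "\<alpha> (1 [^]\<^bsub>integer_group\<^esub> n) = \<alpha> 1 [^]\<^bsub>BijGroup (topspace X)\<^esub> n"
    by (rule hom_int_pow) simp
  then show ?thesis
    by (simp add: iter_def)
qed

text \<open>
  The list \<^term>\<open>sorted_list_of_set F\<close> is the increasing enumeration of \<^term>\<open>F\<close>.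
  Nonemptiness is required because otherwise the length of \<^term>\<open>F\<close> would be meaningless.
\<close>
definition syndetic :: "nat \<Rightarrow> int set \<Rightarrow> bool" where
  "syndetic d F \<longleftrightarrow> finite F \<and> F \<noteq> {} \<and>
     (\<forall>i. Suc i < card F \<longrightarrow>
        sorted_list_of_set F ! Suc i - sorted_list_of_set F ! i \<le> int d)"

definition syndetic_length :: "int set \<Rightarrow> int" where
  "syndetic_length F = Max F - Min F"

definition weakly_wandering :: "'a topology \<Rightarrow> ('a \<Rightarrow> 'a) \<Rightarrow> 'a set \<Rightarrow> bool" where
  "weakly_wandering X T A \<longleftrightarrow> A \<subseteq> topspace X \<and>
     (\<exists>H. infinite H \<and>
        (\<forall>h\<in>H. \<forall>h'\<in>H. h \<noteq> h' \<longrightarrow> iter X T h ` A \<inter> iter X T h' ` A = {}))"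

definition nowhere_dense_in :: "'a topology \<Rightarrow> 'a set \<Rightarrow> bool" where
  "nowhere_dense_in X A \<longleftrightarrow> A \<subseteq> topspace X \<and> X interior_of (X closure_of A) = {}"

definition meager_in :: "'a topology \<Rightarrow> 'a set \<Rightarrow> bool" where
  "meager_in X = countable union_of nowhere_dense_in X"

definition baire_measurable_in :: "'a topology \<Rightarrow> 'a set \<Rightarrow> bool" where
  "baire_measurable_in X A \<longleftrightarrow> A \<subseteq> topspace X \<and>
     (\<exists>U. openin X U \<and> meager_in X ((A - U) \<union> (U - A)))"

end

theory Submission
  imports Defs
begin

text \<open>
  If \<open>A\<close> is a non-meager Baire measurable weakly wandering set, then \<open>A\<close> agrees modulo meager
  sets with a nonempty open set \<open>U\<close>, and by the Baire category theorem \<open>U\<close> is weakly wandering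
  with the same witness \<open>H\<close>. If the translates of \<open>U\<close> by a finite set \<open>F\<close> have a common point, then
  the sets \<open>F + h\<close>, \<open>h \<in> H\<close>, are pairwise disjoint. When \<open>F\<close> is \<open>d\<close>-syndetic and long, then \<open>d + 1\<close>
  of these sets meet a common window of \<open>d\<close> consecutive integers, which is impossible.
\<close>

text \<open>The first element of F that is at least a works: its predecessor in the enumeration lies
  below a, and the gap between the two is at most d.\<close>

lemma syndetic_meets_window:
  assumes F: "syndetic d F" and d: "d \<ge> 1" and a: "Min F \<le> a" "a \<le> Max F"
  shows "\<exists>n\<in>F. a \<le> n \<and> n < a + int d"
proof -
  define xs where "xs = sorted_list_of_set F"
  have fin: "finite F" and ne: "F \<noteq> {}"
    and gap: "\<And>i. Suc i < card F \<Longrightarrow> xs ! Suc i - xs ! i \<le> int d"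
    using F by (auto simp: syndetic_def xs_def)
  have set: "set xs = F" and len: "length xs = card F" and sorted: "sorted xs"
    using fin by (auto simp: xs_def)
  have ex: "\<exists>i. i < length xs \<and> a \<le> xs ! i"
    using Max_in[OF fin ne] a(2) set by (metis in_set_conv_nth)
  define i where "i = (LEAST i. i < length xs \<and> a \<le> xs ! i)"
  have i: "i < length xs" "a \<le> xs ! i"
    using LeastI_ex[OF ex] by (auto simp: i_def)
  have "xs ! i < a + int d"
  proof (cases i)
    case 0
    \<comment> \<open>Without a predecessor the gap bound says nothing; here \<open>xs ! 0\<close>
      is squeezed to equal a, and \<open>d \<ge> 1\<close> gives the strict bound.\<close>
    obtain j where "j < length xs" "xs ! j = Min F"
      using Min_in[OF fin ne] set by (metis in_set_conv_nth)
    then have "xs ! i \<le> a"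
      using sorted_nth_mono[OF sorted, of 0 j] 0 a(1) by simp
    then show ?thesis
      using d by simp
  next
    case (Suc k)
    then have "xs ! k < a"
      using not_less_Least[of k "\<lambda>i. i < length xs \<and> a \<le> xs ! i"] i(1) by (force simp: i_def)
    then show ?thesis
      using gap[of k] i(1) Suc len by simp
  qed
  then show ?thesis
    using i set nth_mem by blast
qed

text \<open>Pigeonhole: more than d translates of F all meet one window of d integers, so two of
  them meet it in the same integer.\<close>

lemma syndetic_translates_overlap:
  assumes F: "syndetic d F" and d: "d \<ge> 1"
    and K: "finite K" "d < card K" "\<And>h. h \<in> K \<Longrightarrow> \<bar>h\<bar> \<le> M"
    and l: "2 * M \<le> syndetic_length F"
  shows "\<exists>h\<in>K. \<exists>h'\<in>K. h \<noteq> h' \<and> (\<exists>n\<in>F. \<exists>n'\<in>F. n + h = n' + h')"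
proof -
  \<comment> \<open>The shift by M centres the window: for \<open>\<bar>h\<bar> \<le> M\<close> the
    point \<open>a - h\<close> lies between \<open>Min F\<close> and \<open>Min F + 2 * M\<close>,
    hence in the range of F.\<close>
  define a where "a = Min F + M"
  have "\<exists>n\<in>F. a \<le> n + h \<and> n + h < a + int d" if "h \<in> K" for h
  proof -
    have "Min F \<le> a - h" "a - h \<le> Max F"
      using K(3)[OF that] l by (auto simp: a_def syndetic_length_def)
    then obtain n where "n \<in> F" "a - h \<le> n" "n < a - h + int d"
      using syndetic_meets_window[OF F d] by blast
    then show ?thesis
      by (intro bexI[of _ n]) auto
  qed
  then obtain f where f: "\<And>h. h \<in> K \<Longrightarrow> f h \<in> F \<and> a \<le> f h + h \<and> f h + h < a + int d"
    by metis
  have "(\<lambda>h. f h + h) ` K \<subseteq> {a..<a + int d}"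
    using f by auto
  then have "card ((\<lambda>h. f h + h) ` K) < card K"
    using card_mono[of "{a..<a + int d}" "(\<lambda>h. f h + h) ` K"] K(2) by simp
  then have "\<not> inj_on (\<lambda>h. f h + h) K"
    by (rule pigeonhole)
  then show ?thesis
    using f unfolding inj_on_def by blast
qed

text \<open>\<open>meager_in\<close> asks for an exact union rather than a cover, so every nowhere
  dense piece is cut down to B.\<close>

lemma meager_in_mono:
  assumes "meager_in X A" "B \<subseteq> A"
  shows "meager_in X B"
proof -
  obtain \<U> where \<U>: "countable \<U>" "\<U> \<subseteq> Collect (nowhere_dense_in X)" "\<Union>\<U> = A"
    using assms(1) by (auto simp: meager_in_def union_of_def)
  have "nowhere_dense_in X (N \<inter> B)" if "nowhere_dense_in X N" for N
    using that interior_of_mono[OF closure_of_mono[of "N \<inter> B" N X], of X]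
    by (auto simp: nowhere_dense_in_def)
  moreover have "\<Union>((\<lambda>N. N \<inter> B) ` \<U>) = B"
    using \<U>(3) assms(2) by auto
  ultimately show ?thesis
    using \<U>(1,2) unfolding meager_in_def union_of_def
    by (intro exI[of _ "(\<lambda>N. N \<inter> B) ` \<U>"]) auto
qed

lemma meager_in_Un: "meager_in X A \<Longrightarrow> meager_in X B \<Longrightarrow> meager_in X (A \<union> B)"
  unfolding meager_in_def by (rule countable_union_of_Un)

text \<open>A homeomorphism commutes with closure and interior, so it carries nowhere dense pieces
  to nowhere dense pieces.\<close>

lemma meager_in_homeomorphic_image:
  assumes f: "homeomorphic_map X Y f" and A: "meager_in X A"
  shows "meager_in Y (f ` A)"
proof -
  obtain \<U> where \<U>: "countable \<U>" "\<U> \<subseteq> Collect (nowhere_dense_in X)" "\<Union>\<U> = A"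
    using A by (auto simp: meager_in_def union_of_def)
  have "nowhere_dense_in Y (f ` N)" if "nowhere_dense_in X N" for N
  proof -
    have N: "N \<subseteq> topspace X" "X interior_of (X closure_of N) = {}"
      using that by (auto simp: nowhere_dense_in_def)
    have "Y interior_of (Y closure_of (f ` N)) = f ` (X interior_of (X closure_of N))"
      using homeomorphic_map_closure_of[OF f N(1)]
        homeomorphic_map_interior_of[OF f closure_of_subset_topspace] by metis
    then show ?thesis
      using N homeomorphic_imp_surjective_map[OF f] unfolding nowhere_dense_in_def by blast
  qed
  then show ?thesis
    using \<U> unfolding meager_in_def union_of_def
    by (intro exI[of _ "image f ` \<U>"]) auto
qed

text \<open>The closures of the pieces of W are closed with empty interior; by Baire their union has
  empty interior too, yet it contains the open set W.\<close>

lemma meager_open_empty: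
  assumes X: "completely_metrizable_space X" and W: "openin X W" "meager_in X W"
  shows "W = {}"
proof -
  obtain \<U> where \<U>: "countable \<U>" "\<U> \<subseteq> Collect (nowhere_dense_in X)" "\<Union>\<U> = W"
    using W(2) by (auto simp: meager_in_def union_of_def)
  have "X interior_of \<Union>((closure_of) X ` \<U>) = {}"
    using X \<U>(1,2) by (intro Baire_category_alt) (auto simp: nowhere_dense_in_def)
  moreover have "N \<subseteq> X closure_of N" if "N \<in> \<U>" for N
    using that \<U>(2) unfolding nowhere_dense_in_def by (intro closure_of_subset) blast
  then have "W \<subseteq> \<Union>((closure_of) X ` \<U>)"
    using \<U>(3) by blast
  ultimately show ?thesis
    using interior_of_maximal[OF _ W(1)] by blast
qed

context
  fixes X :: "'a topology" and \<alpha> :: "int \<Rightarrow> 'a \<Rightarrow> 'a"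
  assumes \<alpha>: "polish_Z_space X \<alpha>"
begin

interpretation group_action integer_group "topspace X" \<alpha>
  using \<alpha> by (simp add: polish_Z_space_def)

lemma action_add: "x \<in> topspace X \<Longrightarrow> \<alpha> (m + n) x = \<alpha> m (\<alpha> n x)"
  using composition_rule[of x m n] by simp

lemma action_zero: "x \<in> topspace X \<Longrightarrow> \<alpha> 0 x = x"
  using id_eq_one by (metis one_integer_group restrict_apply')

lemma action_homeomorphic_map: "homeomorphic_map X X (\<alpha> n)"
proof -
  have cont: "continuous_map X X (\<alpha> m)" for m
  proof -
    have "continuous_map X (prod_topology (discrete_topology UNIV) X) (\<lambda>x. (m, x))"
      by (simp add: continuous_map_pairwise o_def)
    moreover have "continuous_map (prod_topology (discrete_topology UNIV) X) X (\<lambda>(n, x). \<alpha> n x)"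
      using \<alpha> by (simp add: polish_Z_space_def)
    ultimately have "continuous_map X X ((\<lambda>(n, x). \<alpha> n x) \<circ> (\<lambda>x. (m, x)))"
      by (rule continuous_map_compose)
    then show ?thesis
      by (simp add: o_def)
  qed
  have "homeomorphic_maps X X (\<alpha> n) (\<alpha> (- n))"
    using cont action_zero by (auto simp: homeomorphic_maps_def simp flip: action_add)
  then show ?thesis
    by (auto simp: homeomorphic_map_maps)
qed

lemma action_image_add: "U \<subseteq> topspace X \<Longrightarrow> \<alpha> (m + n) ` U = \<alpha> m ` \<alpha> n ` U"
  unfolding image_image by (intro image_cong refl action_add) auto

text \<open>A common point of the translates of U cannot come from A on both sides, so it lies in a
  translate of the meager set \<open>U - A\<close>. The intersection is thus open and
  meager.\<close>

lemma weakly_wandering_open_kernel: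
  assumes "openin X U" "meager_in X (U - A)" "\<alpha> m ` A \<inter> \<alpha> n ` A = {}"
  shows "\<alpha> m ` U \<inter> \<alpha> n ` U = {}"
proof (rule meager_open_empty)
  show "completely_metrizable_space X"
    using \<alpha> by (simp add: polish_Z_space_def polish_topology_def)
  show "openin X (\<alpha> m ` U \<inter> \<alpha> n ` U)"
    using assms(1) homeomorphic_imp_open_map[OF action_homeomorphic_map]
    by (auto simp: open_map_def)
  have "meager_in X (\<alpha> m ` (U - A) \<union> \<alpha> n ` (U - A))"
    by (intro meager_in_Un meager_in_homeomorphic_image[OF action_homeomorphic_map] assms(2))
  then show "meager_in X (\<alpha> m ` U \<inter> \<alpha> n ` U)"
    by (rule meager_in_mono) (use assms(3) in blast)
qed

lemma disjoint_translates_of_return_times: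
  assumes "U \<subseteq> topspace X" "\<alpha> h ` U \<inter> \<alpha> h' ` U = {}" "(\<Inter>n\<in>F. \<alpha> n ` U) \<noteq> {}"
    and n: "n \<in> F" "n' \<in> F"
  shows "n + h \<noteq> n' + h'"
proof
  assume eq: "n + h = n' + h'"
  obtain x where "x \<in> \<alpha> n ` U" "x \<in> \<alpha> n' ` U"
    using assms(3) n by blast
  \<comment> \<open>Translation by \<open>h - n'\<close> moves n' to h and, by \<open>eq\<close>, n
    to h', so x is sent to a common point of two disjoint translates.\<close>
  then have "\<alpha> (h - n') x \<in> \<alpha> ((h - n') + n) ` U \<inter> \<alpha> ((h - n') + n') ` U"
    using assms(1) by (simp only: action_image_add) blast
  moreover have "(h - n') + n = h'" "(h - n') + n' = h"
    using eq by auto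
  ultimately show False
    using assms(2) by auto
qed

end

theorem theorem11p7:
  fixes X :: "'a topology" and \<alpha> :: "int \<Rightarrow> 'a \<Rightarrow> 'a" and T :: "'a \<Rightarrow> 'a"
  assumes "polish_Z_space X \<alpha>"
    and "T = \<alpha> 1"
    and "\<And>V. openin X V \<Longrightarrow> V \<noteq> {} \<Longrightarrow>
           \<exists>d::nat. d \<ge> 1 \<and>
             (\<forall>l::nat. l \<ge> 1 \<longrightarrow>
               (\<exists>F::int set. syndetic d F \<and> syndetic_length F \<ge> int l \<and>
                  (\<Inter>n\<in>F. iter X T n ` V) \<noteq> {}))"
  shows "\<not> (\<exists>A. A \<subseteq> topspace X \<and> \<not> meager_in X A \<and> baire_measurable_in X A \<and>
              weakly_wandering X T A)"
proof
  assume "\<exists>A. A \<subseteq> topspace X \<and> \<not> meager_in X A \<and> baire_measurable_in X A \<and>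
              weakly_wandering X T A"
  then obtain A U H where A: "\<not> meager_in X A"
    and U: "openin X U" "meager_in X ((A - U) \<union> (U - A))"
    and H: "infinite H"
      "\<And>h h'. h \<in> H \<Longrightarrow> h' \<in> H \<Longrightarrow> h \<noteq> h' \<Longrightarrow> iter X T h ` A \<inter> iter X T h' ` A = {}"
    unfolding baire_measurable_in_def weakly_wandering_def by metis
  have iter: "iter X T n = \<alpha> n" for n
    using iter_action[OF assms(1)] assms(2) by simp
  \<comment> \<open>For empty U the symmetric difference would be A itself, which is not
    meager.\<close>
  have "U \<noteq> {}"
    using A U(2) by auto
  have "meager_in X (U - A)"
    using U(2) by (rule meager_in_mono) blast
  then have disj: "\<alpha> h ` U \<inter> \<alpha> h' ` U = {}" if "h \<in> H" "h' \<in> H" "h \<noteq> h'" for h h'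
    using weakly_wandering_open_kernel[OF assms(1) U(1)] H(2)[OF that] by (simp add: iter)
  obtain d where d: "d \<ge> 1"
    and F: "\<And>l. l \<ge> 1 \<Longrightarrow> \<exists>F. syndetic d F \<and> syndetic_length F \<ge> int l \<and> (\<Inter>n\<in>F. \<alpha> n ` U) \<noteq> {}"
    using assms(3)[OF U(1) \<open>U \<noteq> {}\<close>] by (auto simp: iter)
  \<comment> \<open>The bound d depends on U alone, so K can be chosen after d, with one element
    more than the window has integers, and F after K.\<close>
  obtain K where K: "finite K" "card K = Suc d" "K \<subseteq> H"
    using infinite_arbitrarily_large[OF H(1)] by metis
  define M where "M = (\<Sum>h\<in>K. \<bar>h\<bar>)"
  have M: "\<bar>h\<bar> \<le> M" if "h \<in> K" for h
    unfolding M_def using that K(1) by (intro member_le_sum) auto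
  \<comment> \<open>The summand 1 makes the requested length at least 1 whatever M is.\<close>
  obtain F where syn: "syndetic d F" and len: "int (nat (2 * M) + 1) \<le> syndetic_length F"
    and ne: "(\<Inter>n\<in>F. \<alpha> n ` U) \<noteq> {}"
    using F[of "nat (2 * M) + 1"] by auto
  have "d < card K" "2 * M \<le> syndetic_length F"
    using K(2) len by linarith+
  from syndetic_translates_overlap[OF syn d K(1) this(1) M this(2)]
  obtain h h' n n' where "h \<in> K" "h' \<in> K" "h \<noteq> h'" and n: "n \<in> F" "n' \<in> F" "n + h = n' + h'"
    by blast
  then have "\<alpha> h ` U \<inter> \<alpha> h' ` U = {}"
    using disj K(3) by blast
  then show False
    using disjoint_translates_of_return_times[OF assms(1) openin_subset[OF U(1)] _ ne] n by blast
qed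

end
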